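(* Let $Y$ be a simplicial complex with vertex set $V(Y)$ and set of maximal faces (facets) $M(Y)$. Let $G=G(Y)$ be the bipartite graph whose vertex set is the disjoint union $V(Y)\sqcup M(Y)$, and in which $v\in V(Y)$ and $w\in M(Y)$ are joined by an edge if and only if $v\notin w$ (and there are no other edges). Suppose $Y$ satisfies the Vertex Separation Condition: $Y$ contains four facets $\Delta_0,\Delta_1,\Delta_2,\Delta_3$ and three vertices $a_1,a_2,a_3$ such that for each $i\in\{1,2,3\}$ one has $a_i\in\Delta_i$, and $a_i\notin\Delta_j$ for every $j\in\{0,1,2,3\}$ with $j\neq i$. Then $G$ is not a circle graph.
   Context: A chord diagram is a circle together with a finite set of chords with pairwise disjoint boundary points (so all the endpoints on the circle are distinct). Its associated circle graph is the intersection graph of the chords: the simple graph with one vertex for each chord, two vertices being joined by an edge if and only if the corresponding chords intersect (equivalently, their endpoints alternate along the circle). A graph is called a circle graph if it is isomorphic to the circle graph associated to some chord diagram. A facet of a simplicial complex is a simplex that is maximal with respect to inclusion. *)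

theory Defs
  imports "HOL-Analysis.Analysis"
begin

text \<open>Simple graphs as a vertex set together with a set of two-element edges.\<close>

type_synonym 'v sgraph = "'v set \<times> 'v set set"

definition simple_graph :: "'v sgraph \<Rightarrow> bool" where
  "simple_graph G \<longleftrightarrow> (\<forall>e\<in>snd G. e \<subseteq> fst G \<and> card e = 2)"

definition sgraph_iso :: "'v sgraph \<Rightarrow> 'w sgraph \<Rightarrow> bool" where
  "sgraph_iso G H \<longleftrightarrow>
     (\<exists>f. bij_betw f (fst G) (fst H) \<and>
          (\<forall>u\<in>fst G. \<forall>v\<in>fst G. {u, v} \<in> snd G \<longleftrightarrow> {f u, f v} \<in> snd H))"

text \<open>A chord of a circle is encoded by the set of its two boundary points; the chord
  itself is the straight segment joining them, i.e. the convex hull of that set.\<close>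

definition chord_diagram :: "complex \<Rightarrow> real \<Rightarrow> complex set set \<Rightarrow> bool" where
  "chord_diagram z r D \<longleftrightarrow>
     r > 0 \<and> finite D \<and> (\<forall>c\<in>D. c \<subseteq> sphere z r \<and> card c = 2) \<and> pairwise disjnt D"

definition chord_graph :: "complex set set \<Rightarrow> complex set sgraph" where
  "chord_graph D =
     (D, {{c, d} | c d. c \<in> D \<and> d \<in> D \<and> c \<noteq> d \<and> convex hull c \<inter> convex hull d \<noteq> {}})"

definition circle_graph :: "'v sgraph \<Rightarrow> bool" where
  "circle_graph G \<longleftrightarrow> (\<exists>z r D. chord_diagram z r D \<and> sgraph_iso G (chord_graph D))"

text \<open>Abstract simplicial complexes, not necessarily finite. Closure is required for
  nonempty subsets only, so the empty simplex may or may not be counted as a face.\<close>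

definition abstract_simplicial_complex :: "'a set set \<Rightarrow> bool" where
  "abstract_simplicial_complex Y \<longleftrightarrow>
     (\<forall>s\<in>Y. finite s) \<and> (\<forall>s\<in>Y. \<forall>t. t \<subseteq> s \<and> t \<noteq> {} \<longrightarrow> t \<in> Y)"

definition complex_vertices :: "'a set set \<Rightarrow> 'a set" where
  "complex_vertices Y = {v. {v} \<in> Y}"

definition facets :: "'a set set \<Rightarrow> 'a set set" where
  "facets Y = {s \<in> Y. \<forall>t\<in>Y. s \<subseteq> t \<longrightarrow> t = s}"

definition nonincidence_graph :: "'a set set \<Rightarrow> ('a + 'a set) sgraph" where
  "nonincidence_graph Y =
     (complex_vertices Y <+> facets Y,
      {{Inl v, Inr w} | v w. v \<in> complex_vertices Y \<and> w \<in> facets Y \<and> v \<notin> w})"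

text \<open>The facets \<open>\<Delta> 0, \<dots>, \<Delta> 3\<close> and the vertices \<open>a 1, a 2, a 3\<close> below are automatically
  pairwise distinct.\<close>

definition vertex_separation_condition :: "'a set set \<Rightarrow> bool" where
  "vertex_separation_condition Y \<longleftrightarrow>
     (\<exists>(\<Delta> :: nat \<Rightarrow> 'a set) (a :: nat \<Rightarrow> 'a).
        (\<forall>j\<in>{0, 1, 2, 3}. \<Delta> j \<in> facets Y) \<and>
        (\<forall>i\<in>{1, 2, 3}. a i \<in> complex_vertices Y) \<and>
        (\<forall>i\<in>{1, 2, 3}. a i \<in> \<Delta> i \<and> (\<forall>j\<in>{0, 1, 2, 3}. j \<noteq> i \<longrightarrow> a i \<notin> \<Delta> j)))"

lemma simple_graph_chord_graph: "simple_graph (chord_graph D)"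
  unfolding simple_graph_def chord_graph_def
proof (intro ballI)
  fix e assume "e \<in> snd (D, {{c, d} | c d. c \<in> D \<and> d \<in> D \<and> c \<noteq> d \<and> convex hull c \<inter> convex hull d \<noteq> {}})"
  then obtain c d where "e = {c, d}" "c \<in> D" "d \<in> D" "c \<noteq> d" by auto
  then show "e \<subseteq> fst (D, {{c, d} | c d. c \<in> D \<and> d \<in> D \<and> c \<noteq> d \<and> convex hull c \<inter> convex hull d \<noteq> {}}) \<and> card e = 2"
    by simp
qed

lemma simple_graph_nonincidence_graph: "simple_graph (nonincidence_graph Y)"
  by (auto simp: simple_graph_def nonincidence_graph_def)

end

theory Submission imports Defs
begin

text \<open>If a chord meets three pairwise disjoint chords, then one of the three lies between the
  other two, and any chord meeting the outer two must meet the middle one as well. The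
  vertices \<open>a\<^sub>1, a\<^sub>2, a\<^sub>3\<close> would give such a triple, all met by \<open>\<Delta>\<^sub>0\<close>, although \<open>\<Delta>\<^sub>i\<close> misses
  \<open>a\<^sub>i\<close> and meets the other two.\<close>

text \<open>Since \<open>\<i> * (v - u)\<close> is \<open>v - u\<close> turned by a right angle, the
  last hypothesis puts \<open>x\<close> on the line through \<open>u\<close> and \<open>v\<close>.
  Along that line the squared distance to \<open>z\<close> minus \<open>r\<^sup>2\<close> is a
  quadratic in the affine coordinate \<open>t\<close> with roots 0 at \<open>u\<close> and 1 at
  \<open>v\<close>, so lying in the disc forces \<open>t\<close> between 0 and 1.\<close>

lemma line_Int_cball_subset_chord:
  fixes u v x z :: complex
  assumes "u \<in> sphere z r" "v \<in> sphere z r" "u \<noteq> v" "x \<in> cball z r"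
    and "(\<i> * (v - u)) \<bullet> x = (\<i> * (v - u)) \<bullet> u"
  shows "x \<in> closed_segment u v"
proof -
  define d where "d = v - u"
  \<comment> \<open>The coordinate of the orthogonal projection of \<open>x\<close> to the line,
    scaled so that \<open>u\<close> is at 0 and \<open>v\<close> at 1.\<close>
  define t where "t = (d \<bullet> (x - u)) / (d \<bullet> d)"
  have "d \<noteq> 0" using assms(3) by (simp add: d_def)
  then have dd: "d \<bullet> d > 0" by simp
  have perp: "Re d * Im (x - u) = Im d * Re (x - u)"
    using assms(5) by (simp add: inner_complex_def d_def algebra_simps)
  have tdd: "t * (d \<bullet> d) = d \<bullet> (x - u)" using dd by (simp add: t_def)
  \<comment> \<open>By \<open>perp\<close> the cross product of \<open>d\<close> and
    \<open>x - u\<close> vanishes, so \<open>x - u\<close> equals its own projection to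
    \<open>d\<close>.\<close>
  have "(d \<bullet> d) * Re (x - u) = (d \<bullet> (x - u)) * Re d" "(d \<bullet> d) * Im (x - u) = (d \<bullet> (x - u)) * Im d"
    using perp unfolding inner_complex_def by algebra+
  then have xu: "x - u = t *\<^sub>R d"
    using dd by (simp add: complex_eq_iff t_def field_simps)
  have norms: "(u - z) \<bullet> (u - z) = r\<^sup>2" "(u - z + d) \<bullet> (u - z + d) = r\<^sup>2"
    using assms(1,2) by (auto simp: d_def dot_square_norm dist_norm norm_minus_commute)
  have "(x - z) \<bullet> (x - z) \<le> r\<^sup>2"
    using assms(4) by (simp add: dot_square_norm dist_norm norm_minus_commute power_mono)
  moreover have "x - z = u - z + t *\<^sub>R d" using xu by (simp add: algebra_simps)
  ultimately have "(u - z + t *\<^sub>R d) \<bullet> (u - z + t *\<^sub>R d) \<le> r\<^sup>2" by simp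
  then have le: "(u - z) \<bullet> (u - z) + 2 * t * ((u - z) \<bullet> d) + t\<^sup>2 * (d \<bullet> d) \<le> r\<^sup>2"
    unfolding inner_add_left inner_add_right
    by (simp add: inner_commute power2_eq_square algebra_simps)
  \<comment> \<open>Both ends of the chord are at distance \<open>r\<close> from \<open>z\<close>;
    subtracting the two equations in \<open>norms\<close> determines the linear coefficient of the
    quadratic in \<open>le\<close>.\<close>
  have "2 * ((u - z) \<bullet> d) = - (d \<bullet> d)"
    using norms unfolding inner_add_left inner_add_right by (simp add: inner_commute)
  then have "2 * t * ((u - z) \<bullet> d) = - (t * (d \<bullet> d))"
    by (metis mult.assoc mult.commute mult_minus_right)
  with le norms(1) have "t * (t - 1) * (d \<bullet> d) \<le> 0"
    by (simp add: power2_eq_square left_diff_distrib right_diff_distrib)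
  then have "t * (t - 1) \<le> 0" using dd by (simp add: mult_le_0_iff)
  then have "0 \<le> t" "t \<le> 1" by (auto simp: mult_le_0_iff)
  moreover have "x = (1 - t) *\<^sub>R u + t *\<^sub>R v" using xu by (simp add: d_def algebra_simps)
  ultimately show ?thesis unfolding closed_segment_def by blast
qed

text \<open>Inside the disc, avoiding the chord means avoiding its whole line. A connected set that
  avoids a line lies in one of the two open half-planes, and these are convex, so the hull stays on
  the same side.\<close>

lemma convex_hull_connected_disjnt_chord:
  fixes u v z :: complex
  assumes "u \<in> sphere z r" "v \<in> sphere z r" "u \<noteq> v"
    and "connected T" "T \<subseteq> cball z r" "T \<inter> closed_segment u v = {}"
  shows "convex hull T \<inter> closed_segment u v = {}"
proof -
  define a where "a = \<i> * (v - u)"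
  define b where "b = a \<bullet> u"
  have "a \<bullet> v = b" by (simp add: a_def b_def inner_complex_def algebra_simps)
  then have "closed_segment u v \<subseteq> {x. a \<bullet> x = b}"
    by (intro closed_segment_subset convex_hyperplane) (auto simp: b_def)
  moreover have "a \<bullet> x \<noteq> b" if "x \<in> T" for x
    using line_Int_cball_subset_chord[OF assms(1-3)] that assms(5,6) unfolding a_def b_def by blast
  then have "T \<subseteq> {x. a \<bullet> x < b} \<or> T \<subseteq> {x. a \<bullet> x > b}"
    using connected_ivt_hyperplane[OF assms(4)] by (smt (verit) mem_Collect_eq subsetI)
  then have "convex hull T \<subseteq> {x. a \<bullet> x < b} \<or> convex hull T \<subseteq> {x. a \<bullet> x > b}"
    using hull_minimal[where S = convex] convex_halfspace_lt convex_halfspace_gt by metis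
  ultimately show ?thesis by force
qed

lemma convex_hull_chord:
  assumes "chord_diagram z r D" "c \<in> D"
  obtains u v where "u \<in> sphere z r" "v \<in> sphere z r" "u \<noteq> v" "convex hull c = closed_segment u v"
proof -
  have "c \<subseteq> sphere z r" "card c = 2" using assms by (auto simp: chord_diagram_def)
  moreover from this obtain u v where "c = {u, v}" "u \<noteq> v" by (auto simp: card_2_iff)
  ultimately show ?thesis by (intro that[of u v]) (auto simp: segment_convex_hull)
qed

lemma convex_hull_chord_subset_cball:
  assumes "chord_diagram z r D" "c \<in> D"
  shows "convex hull c \<subseteq> cball z r"
proof (rule hull_minimal)
  have "c \<subseteq> sphere z r" using assms by (simp add: chord_diagram_def)
  then show "c \<subseteq> cball z r" using sphere_cball by blast
qed simp

lemma chord_graph_edge_iff: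
  assumes "c \<in> D" "d \<in> D" "c \<noteq> d"
  shows "{c, d} \<in> snd (chord_graph D) \<longleftrightarrow> convex hull c \<inter> convex hull d \<noteq> {}"
  using assms unfolding chord_graph_def snd_conv mem_Collect_eq doubleton_eq_iff
  by (metis Int_commute)

lemma nonincidence_graph_edge_iff:
  "{Inr w, Inl v} \<in> snd (nonincidence_graph Y) \<longleftrightarrow>
    v \<in> complex_vertices Y \<and> w \<in> facets Y \<and> v \<notin> w"
  "{Inl u, Inl v} \<notin> snd (nonincidence_graph Y)"
  by (auto simp: nonincidence_graph_def doubleton_eq_iff)

text \<open>The chord \<open>e\<close> links \<open>c\<^sub>1\<close> to \<open>c\<^sub>2\<close>,
  so the three together form a connected subset of the disc that misses \<open>c\<close>. Its convex
  hull then misses \<open>c\<close> as well, yet contains the segment from \<open>p\<^sub>1\<close>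
  to \<open>p\<^sub>2\<close>.\<close>

lemma no_chord_around_middle:
  assumes D: "chord_diagram z r D" "c \<in> D" "c\<^sub>1 \<in> D" "c\<^sub>2 \<in> D" "e \<in> D"
    and e: "convex hull e \<inter> convex hull c\<^sub>1 \<noteq> {}" "convex hull e \<inter> convex hull c\<^sub>2 \<noteq> {}"
    and disj: "convex hull e \<inter> convex hull c = {}" "convex hull c\<^sub>1 \<inter> convex hull c = {}"
      "convex hull c\<^sub>2 \<inter> convex hull c = {}"
    and p: "p \<in> convex hull c" "p\<^sub>1 \<in> convex hull c\<^sub>1" "p\<^sub>2 \<in> convex hull c\<^sub>2"
  shows "\<not> between (p\<^sub>1, p\<^sub>2) p"
proof
  assume "between (p\<^sub>1, p\<^sub>2) p"
  define T where "T = convex hull c\<^sub>1 \<union> convex hull e \<union> convex hull c\<^sub>2"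
  obtain u v where uv: "u \<in> sphere z r" "v \<in> sphere z r" "u \<noteq> v"
    "convex hull c = closed_segment u v"
    using convex_hull_chord[OF D(1,2)] .
  have "connected (convex hull c\<^sub>1 \<union> convex hull e)"
    using e(1) by (intro connected_Un) (simp_all add: convex_connected Int_commute[of "convex hull e"])
  moreover have "(convex hull c\<^sub>1 \<union> convex hull e) \<inter> convex hull c\<^sub>2 \<noteq> {}" using e(2) by blast
  ultimately have "connected T"
    unfolding T_def by (rule connected_Un[OF _ convex_connected[OF convex_convex_hull]])
  moreover have "T \<subseteq> cball z r"
    using convex_hull_chord_subset_cball[OF D(1)] D by (simp add: T_def)
  moreover have "T \<inter> closed_segment u v = {}" using disj uv(4) by (auto simp: T_def)
  ultimately have "convex hull T \<inter> closed_segment u v = {}"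
    using convex_hull_connected_disjnt_chord uv(1-3) by blast
  moreover have "p\<^sub>1 \<in> convex hull T" "p\<^sub>2 \<in> convex hull T"
    using p by (auto simp: T_def intro: hull_inc)
  then have "closed_segment p\<^sub>1 p\<^sub>2 \<subseteq> convex hull T"
    by (intro closed_segment_subset) auto
  moreover have "p \<in> closed_segment p\<^sub>1 p\<^sub>2"
    using \<open>between (p\<^sub>1, p\<^sub>2) p\<close> by (simp add: between_mem_segment)
  ultimately show False using p(1) uv(4) by blast
qed

text \<open>The separation condition in terms of chords: \<open>c i\<close> stands for the vertex
  \<open>a i\<close> and \<open>e j\<close> for the facet \<open>\<Delta> j\<close>. The chord
  \<open>e 0\<close> serves only to carry three collinear points, one on each \<open>c i\<close>;
  the other \<open>e j\<close> rule out each possible middle point.\<close>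

lemma no_separated_chord_triple:
  fixes c e :: "nat \<Rightarrow> complex set"
  assumes D: "chord_diagram z r D"
    and cD: "\<And>i. i \<in> {1, 2, 3} \<Longrightarrow> c i \<in> D"
    and eD: "\<And>j. j \<in> {0, 1, 2, 3} \<Longrightarrow> e j \<in> D"
    and disj: "\<And>i j. i \<in> {1, 2, 3} \<Longrightarrow> j \<in> {1, 2, 3} \<Longrightarrow> i \<noteq> j \<Longrightarrow>
      convex hull c i \<inter> convex hull c j = {}"
    and meet: "\<And>i j. i \<in> {1, 2, 3} \<Longrightarrow> j \<in> {0, 1, 2, 3} \<Longrightarrow>
      convex hull e j \<inter> convex hull c i \<noteq> {} \<longleftrightarrow> i \<noteq> j"
  shows False
proof -
  have "\<exists>x. x \<in> convex hull e 0 \<inter> convex hull c i" if "i \<in> {1, 2, 3}" for i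
    using meet[of i 0] that by auto
  then obtain p where p: "\<And>i. i \<in> {1, 2, 3} \<Longrightarrow> p i \<in> convex hull e 0 \<inter> convex hull c i"
    by metis
  have middle: "\<not> between (p i, p k) (p j)"
    if ijk: "i \<in> {1, 2, 3}" "j \<in> {1, 2, 3}" "k \<in> {1, 2, 3}" "i \<noteq> j" "k \<noteq> j" for i j k
  \<comment> \<open>The linking chord is \<open>e j\<close>, which meets \<open>c i\<close> and
    \<open>c k\<close> but misses \<open>c j\<close>.\<close>
  proof (rule no_chord_around_middle[OF D cD[of j] cD[of i] cD[of k] eD[of j]])
    have j: "j \<in> {0, 1, 2, 3}" using ijk(2) by simp
    then show "j \<in> {0, 1, 2, 3}" .
    show "convex hull e j \<inter> convex hull c i \<noteq> {}" "convex hull e j \<inter> convex hull c k \<noteq> {}"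
      "convex hull e j \<inter> convex hull c j = {}"
      using meet[OF ijk(1) j] meet[OF ijk(3) j] meet[OF ijk(2) j] ijk(4,5) by simp_all
    show "convex hull c i \<inter> convex hull c j = {}" "convex hull c k \<inter> convex hull c j = {}"
      using disj[OF ijk(1,2,4)] disj[OF ijk(3,2,5)] by simp_all
    show "p j \<in> convex hull c j" "p i \<in> convex hull c i" "p k \<in> convex hull c k"
      using p[OF ijk(1)] p[OF ijk(2)] p[OF ijk(3)] by simp_all
  qed (fact ijk)+
  have e0: "e 0 \<in> D" using eD by simp
  obtain u v where "u \<in> sphere z r" "v \<in> sphere z r" "u \<noteq> v"
    and e0_eq: "convex hull e 0 = closed_segment u v"
    using convex_hull_chord[OF D e0] .
  have "{p 1, p 2, p 3} \<subseteq> closed_segment u v"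
    using p[of 1] p[of 2] p[of 3] by (simp add: e0_eq)
  then have "collinear {p 1, p 2, p 3}"
    by (rule collinear_subset[OF collinear_closed_segment])
  then show False
    \<comment> \<open>The three instances exclude \<open>p 1\<close>, \<open>p 2\<close> and
      \<open>p 3\<close> in turn as the middle point, with the outer points in the order used by
      \<open>collinear_between_cases\<close>.\<close>
    using middle[of 2 1 3] middle[of 3 2 1] middle[of 1 3 2] by (simp add: collinear_between_cases)
qed

theorem theorem4p4:
  fixes Y :: "'a set set"
  assumes "abstract_simplicial_complex Y"
    and "vertex_separation_condition Y"
  shows "\<not> circle_graph (nonincidence_graph Y)"
proof
  assume "circle_graph (nonincidence_graph Y)"
  then obtain z r D f where D: "chord_diagram z r D"
    and bij: "bij_betw f (complex_vertices Y <+> facets Y) D"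
    and edge: "\<And>s t. s \<in> complex_vertices Y <+> facets Y \<Longrightarrow> t \<in> complex_vertices Y <+> facets Y \<Longrightarrow>
      {s, t} \<in> snd (nonincidence_graph Y) \<longleftrightarrow> {f s, f t} \<in> snd (chord_graph D)"
    by (auto simp: circle_graph_def sgraph_iso_def nonincidence_graph_def chord_graph_def)
  obtain \<Delta> :: "nat \<Rightarrow> 'a set" and a :: "nat \<Rightarrow> 'a"
    where \<Delta>: "\<And>j. j \<in> {0, 1, 2, 3} \<Longrightarrow> \<Delta> j \<in> facets Y"
      and a: "\<And>i. i \<in> {1, 2, 3} \<Longrightarrow> a i \<in> complex_vertices Y"
      and sep: "\<And>i j. i \<in> {1, 2, 3} \<Longrightarrow> j \<in> {0, 1, 2, 3} \<Longrightarrow> a i \<in> \<Delta> j \<longleftrightarrow> i = j"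
    using assms(2) unfolding vertex_separation_condition_def by metis
  have fD: "f s \<in> D" if "s \<in> complex_vertices Y <+> facets Y" for s
    using bij that by (auto simp: bij_betw_def)
  \<comment> \<open>Intersection encodes adjacency only for distinct chords, since a chord always
    meets itself; injectivity of \<open>f\<close> gives the distinctness.\<close>
  have meet: "convex hull f s \<inter> convex hull f t \<noteq> {} \<longleftrightarrow> {s, t} \<in> snd (nonincidence_graph Y)"
    if "s \<in> complex_vertices Y <+> facets Y" "t \<in> complex_vertices Y <+> facets Y" "s \<noteq> t" for s t
  proof -
    have "f s \<noteq> f t" using bij that by (auto simp: bij_betw_def inj_on_def)
    then show ?thesis
      using edge[OF that(1,2)] chord_graph_edge_iff[OF fD[OF that(1)] fD[OF that(2)]] by simp
  qed
  \<comment> \<open>The facet \<open>\<Delta> i\<close> contains \<open>a i\<close> but not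
    \<open>a j\<close>.\<close>
  have inj: "a i \<noteq> a j" if "i \<in> {1, 2, 3}" "j \<in> {1, 2, 3}" "i \<noteq> j" for i j
    using sep[of i i] sep[of j i] that by auto
  show False
  proof (rule no_separated_chord_triple[OF D, of "\<lambda>i. f (Inl (a i))" "\<lambda>j. f (Inr (\<Delta> j))"])
    fix i j :: nat assume "i \<in> {1, 2, 3}" "j \<in> {1, 2, 3}" "i \<noteq> j"
    \<comment> \<open>The graph is bipartite, so two vertices of the complex are never adjacent and
      their chords are disjoint.\<close>
    then show "convex hull f (Inl (a i)) \<inter> convex hull f (Inl (a j)) = {}"
      using meet[of "Inl (a i)" "Inl (a j)"] a[of i] a[of j] inj[of i j]
      by (simp add: nonincidence_graph_edge_iff InlI)
  next
    fix i j :: nat assume "i \<in> {1, 2, 3}" "j \<in> {0, 1, 2, 3}"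
    then show "convex hull f (Inr (\<Delta> j)) \<inter> convex hull f (Inl (a i)) \<noteq> {} \<longleftrightarrow> i \<noteq> j"
      using meet[of "Inr (\<Delta> j)" "Inl (a i)"] a[of i] \<Delta>[of j] sep[of i j]
      by (simp add: nonincidence_graph_edge_iff InlI InrI)
  qed (use fD a \<Delta> in blast)+
qed

end
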